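(* For each $k\in\{3,4,5,6,7\}$, there is a full-rank $1$-perfect code $C\subseteq\mathbb{F}_3^{13}$ whose kernel has dimension $k$.
   Context: $\mathbb{F}_3$ is the field with three elements. $C\subseteq\mathbb{F}_3^{13}$ is a $1$-perfect code if every vector of $\mathbb{F}_3^{13}$ is uniquely represented as $b+c$ with $c\in C$ and $b$ a vector with at most one nonzero coordinate. $C$ is full-rank if its affine span is $\mathbb{F}_3^{13}$. A period of $C$ is a vector $w$ with $C+w=C$; the kernel of $C$ is the maximal linear subspace contained in the set of periods of $C$. *)

theory Defs
  imports "HOL-Analysis.Analysis"
begin

text \<open>The distribution equips the three-element type \<open>Enum.finite_3\<close> with its field structure;
  the constructors, in order, are 0, 1 and 2.\<close>

type_synonym F3 = Enum.finite_3

lemma card_F3: "CARD(F3) = 3"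
  by (simp add: UNIV_finite_3)

definition one_perfect :: "('a::field ^ 'n) set \<Rightarrow> bool" where
  "one_perfect C \<longleftrightarrow>
    (\<forall>x. \<exists>!(b, c). card {i. b $ i \<noteq> 0} \<le> 1 \<and> c \<in> C \<and> x = b + c)"

text \<open>The library's \<open>affine hull\<close> is restricted to real vector spaces.\<close>

definition affine_span :: "('a::field ^ 'n) set \<Rightarrow> ('a ^ 'n) set" where
  "affine_span C =
    {\<Sum>v\<in>S. u v *s v | S u. finite S \<and> S \<subseteq> C \<and> (\<Sum>v\<in>S. u v) = 1}"

definition full_rank :: "('a::field ^ 'n) set \<Rightarrow> bool" where
  "full_rank C \<longleftrightarrow> affine_span C = UNIV"

definition periods :: "('a::field ^ 'n) set \<Rightarrow> ('a ^ 'n) set" where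
  "periods C = {w. (\<lambda>c. c + w) ` C = C}"

definition code_kernel :: "('a::field ^ 'n) set \<Rightarrow> ('a ^ 'n) set" where
  "code_kernel C = (GREATEST K. vec.subspace K \<and> K \<subseteq> periods C)"

lemma zero_in_periods: "0 \<in> periods C"
  by (simp add: periods_def)

lemma add_in_periods:
  assumes "v \<in> periods C" "w \<in> periods C"
  shows "v + w \<in> periods C"
proof -
  have "(\<lambda>c. c + (v + w)) ` C = (\<lambda>c. c + w) ` ((\<lambda>c. c + v) ` C)"
    by (simp add: image_image add.assoc)
  with assms show ?thesis
    by (simp add: periods_def)
qed

text \<open>The greatest subspace in the definition of \<^const>\<open>code_kernel\<close> always exists.\<close>

lemma code_kernel_eq: "code_kernel C = {w. \<forall>a. a *s w \<in> periods C}"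
  unfolding code_kernel_def
proof (rule Greatest_equality)
  let ?K = "{w. \<forall>a. a *s w \<in> periods C}"
  have "vec.subspace ?K"
    by (rule vec.subspaceI)
      (auto simp: zero_in_periods add_in_periods vec.scale_right_distrib vector_smult_assoc)
  moreover have "w \<in> periods C" if "w \<in> ?K" for w
    using that vector_smult_lid[of w] by (metis mem_Collect_eq)
  ultimately show "vec.subspace ?K \<and> ?K \<subseteq> periods C"
    by blast
next
  fix L assume "vec.subspace L \<and> L \<subseteq> periods C"
  then show "L \<le> {w. \<forall>a. a *s w \<in> periods C}"
    using vec.subspace_scale by blast
qed

lemma subspace_code_kernel: "vec.subspace (code_kernel C)"
  and code_kernel_subset_periods: "code_kernel C \<subseteq> periods C"
  and code_kernel_greatest: "vec.subspace L \<Longrightarrow> L \<subseteq> periods C \<Longrightarrow> L \<subseteq> code_kernel C"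
proof -
  show "vec.subspace (code_kernel C)"
    unfolding code_kernel_eq by (rule vec.subspaceI)
      (auto simp: zero_in_periods add_in_periods vec.scale_right_distrib vector_smult_assoc)
  show "code_kernel C \<subseteq> periods C"
    unfolding code_kernel_eq by (metis (mono_tags, lifting) mem_Collect_eq subsetI vector_smult_lid)
  show "L \<subseteq> code_kernel C" if "vec.subspace L" "L \<subseteq> periods C"
    unfolding code_kernel_eq using that vec.subspace_scale by blast
qed

end

theory Submission
  imports Defs
begin

text \<open>
  Take the Hamming code whose check matrix has the thirteen columns (1, 1, 1), (1, 1, -1),
  (1, -1, 1), (1, -1, -1), then (x, 1, 0), (0, x, 1) and (1, 0, x) for x = 0, 1, -1, so that the last
  nine coordinates form three triples. Let t and m be the sums of the entries and of the x-weighted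
  entries in a triple. An error inside the first triple shows up in the second and third checks as
  (s, 0), which reveals its size s and hence the change of t; only its place x remains to be read off
  from the first check. Therefore the first check may depend arbitrarily on t: one may add a
  function of t, multiply m by a sign depending on t, and swap, depending on t, the row (1, 1, 1, 1)
  of the first four coordinates for (1, -1, -1, 1). The same goes, cyclically, for the
  added function and the sign in the other two triples. The code stays 1-perfect. Adding the square
  of t in all three triples makes it full-rank, with kernel of dimension 7, and each of the three
  signs and the row swap cuts the dimension of the kernel by one.
\<close>

section \<open>Arithmetic of the field with three elements; thirteen coordinates\<close>

text \<open>By default the simplifier unfolds 0, 1 and 2 of \<^typ>\<open>F3\<close> into constructors, which blocks all
  ring simplification.\<close>

declare zero_finite_3_def [simp del] one_finite_3_def [simp del] two_finite_3 [simp del]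

lemmas F3_tables = zero_finite_3_def one_finite_3_def plus_finite_3_def uminus_finite_3_def
  minus_finite_3_def times_finite_3_def

lemma F3_cases:
  obtains "a = 0" | "a = 1" | "a = (-1 :: F3)"
  by (cases a) (auto simp: F3_tables)

lemma F3_all: "(\<forall>a. P a) \<longleftrightarrow> P 0 \<and> P 1 \<and> P (-1 :: F3)"
  by (metis F3_cases)

lemma F3_one_simps: "(1 :: F3) + 1 = -1" "(-1 :: F3) - 1 = 1" "(1::F3) \<noteq> -1" "(-1::F3) \<noteq> 1"
  by (simp_all add: F3_tables)

lemma F3_three: "(3 :: F3) = 0"
proof -
  have "(3 :: F3) = 1 + 1 + 1" by simp
  also have "\<dots> = 0" by (simp add: F3_tables)
  finally show ?thesis .
qed

text \<open>The values \<open>g\<close>, \<open>g - e\<close> and \<open>g + e\<close> exhaust the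
  field, so exactly one of them vanishes. They will be the check values left by the three possible
  places of an error inside a triple.\<close>

lemma F3_unique_shift:
  fixes g e :: F3
  assumes "e \<noteq> 0"
    and "g = 0 \<and> g - e \<noteq> 0 \<and> g + e \<noteq> 0 \<Longrightarrow> P"
    and "g \<noteq> 0 \<and> g - e = 0 \<and> g + e \<noteq> 0 \<Longrightarrow> P"
    and "g \<noteq> 0 \<and> g - e \<noteq> 0 \<and> g + e = 0 \<Longrightarrow> P"
  shows P
  using assms by (cases g; cases e) (auto simp: F3_tables)

lemma all_13:
  "(\<forall>i :: 13. P i) \<longleftrightarrow> P 0 \<and> P 1 \<and> P 2 \<and> P 3 \<and> P 4 \<and> P 5 \<and> P 6 \<and> P 7 \<and> P 8 \<and> P 9 \<and>
    P 10 \<and> P 11 \<and> P 12"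
proof -
  have "i \<in> {0, 1, 2, 3, 4, 5, 6, 7, 8, 9, 10, 11, 12}" for i :: 13
  proof (cases i rule: bit1_cases)
    case (of_int z)
    then have "z \<in> {0..<13}" by simp
    then have "z = 0 \<or> z = 1 \<or> z = 2 \<or> z = 3 \<or> z = 4 \<or> z = 5 \<or> z = 6 \<or> z = 7 \<or> z = 8 \<or>
        z = 9 \<or> z = 10 \<or> z = 11 \<or> z = 12"
      by (simp, presburger)
    then show ?thesis
      using of_int(1) by auto
  qed
  then show ?thesis
    by (metis (no_types, lifting) empty_iff insert_iff)
qed

lemma ex_13:
  "(\<exists>i :: 13. P i) \<longleftrightarrow> P 0 \<or> P 1 \<or> P 2 \<or> P 3 \<or> P 4 \<or> P 5 \<or> P 6 \<or> P 7 \<or> P 8 \<or> P 9 \<or>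
    P 10 \<or> P 11 \<or> P 12"
  using all_13[of "\<lambda>i. \<not> P i"] by blast

section \<open>Perfect codes and vectors of weight at most one\<close>

lemma one_perfectI:
  assumes "\<And>x. \<exists>!b. card {i. b $ i \<noteq> 0} \<le> 1 \<and> x - b \<in> C"
  shows "one_perfect C"
  unfolding one_perfect_def
proof
  fix x
  obtain b where b: "card {i. b $ i \<noteq> 0} \<le> 1" "x - b \<in> C"
    and unique: "\<And>b'. card {i. b' $ i \<noteq> 0} \<le> 1 \<Longrightarrow> x - b' \<in> C \<Longrightarrow> b' = b"
    using assms[of x] by blast
  show "\<exists>!(b, c). card {i. b $ i \<noteq> 0} \<le> 1 \<and> c \<in> C \<and> x = b + c"
  proof (rule ex1I[of _ "(b, x - b)"])
    show "case (b, x - b) of (b, c) \<Rightarrow> card {i. b $ i \<noteq> 0} \<le> 1 \<and> c \<in> C \<and> x = b + c"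
      using b by simp
  next
    fix p
    assume "case p of (b, c) \<Rightarrow> card {i. b $ i \<noteq> 0} \<le> 1 \<and> c \<in> C \<and> x = b + c"
    then obtain b' c where p: "p = (b', c)" "card {i. b' $ i \<noteq> 0} \<le> 1" "c \<in> C" "x = b' + c"
      by (cases p) auto
    then have "b' = b"
      by (intro unique) auto
    then show "p = (b, x - b)"
      using p by simp
  qed
qed

lemma card_support_le_1_iff:
  fixes b :: "'a::zero ^ 'n"
  shows "card {i. b $ i \<noteq> 0} \<le> 1 \<longleftrightarrow> (\<exists>i a. b = axis i a)"
proof
  assume "card {i. b $ i \<noteq> 0} \<le> 1"
  then have same: "i = j" if "b $ i \<noteq> 0" "b $ j \<noteq> 0" for i j
    using that card_le_Suc0_iff_eq[of "{i. b $ i \<noteq> 0}"] by simp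
  obtain i where "b = 0 \<or> b $ i \<noteq> 0"
    by (auto simp: vec_eq_iff)
  then have "{j. b $ j \<noteq> 0} \<subseteq> {i}"
    using same by auto
  then have "b = axis i (b $ i)"
    by (auto simp: vec_eq_iff axis_def)
  then show "\<exists>i a. b = axis i a" by blast
next
  assume "\<exists>i a. b = axis i a"
  then obtain i a where "b = axis i a" by blast
  then have "{j. b $ j \<noteq> 0} \<subseteq> {i}"
    by (auto simp: axis_def)
  then show "card {i. b $ i \<noteq> 0} \<le> 1"
    using card_mono[of "{i}"] by fastforce
qed

lemma axis_zero: "axis i 0 = 0"
  by (simp add: axis_def vec_eq_iff)

text \<open>The zero vector is listed apart because \<open>axis i 0\<close> is the same vector for
  every \<open>i\<close>; the remaining representations are unique, which suits the count of
  candidate errors.\<close>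

lemma card_support_F3_le_1_iff:
  fixes y :: "F3 ^ 'n"
  shows "card {i. y $ i \<noteq> 0} \<le> 1 \<longleftrightarrow> y = 0 \<or> (\<exists>i. y = axis i 1) \<or> (\<exists>i. y = axis i (-1))"
proof -
  have "(\<exists>a. y = axis i a) \<longleftrightarrow> y = 0 \<or> y = axis i 1 \<or> y = axis i (-1)" for i
    using F3_all[of "\<lambda>a. y \<noteq> axis i a"] by (auto simp: axis_zero)
  then show ?thesis
    unfolding card_support_le_1_iff by auto
qed

section \<open>Affine spans and dimensions of common kernels\<close>

lemma span_subset_affine_span:
  fixes C :: "('a::field ^ 'n) set"
  assumes "0 \<in> C"
  shows "vec.span C \<subseteq> affine_span C"
proof
  fix x assume "x \<in> vec.span C"
  then obtain S r where S: "finite S" "S \<subseteq> C" and x: "x = (\<Sum>v\<in>S. r v *s v)"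
    by (auto simp: vec.span_explicit)
  \<comment> \<open>The coefficient of the zero vector is free, so it can be chosen to make the
    coefficients sum to 1.\<close>
  define u where "u = r(0 := 1 - sum r (S - {0}))"
  have "(\<Sum>v\<in>insert 0 S. u v *s v) = (\<Sum>v\<in>S - {0}. u v *s v)"
    using S(1) by (intro sum.mono_neutral_right) auto
  also have "\<dots> = (\<Sum>v\<in>S - {0}. r v *s v)"
    by (intro sum.cong) (auto simp: u_def)
  also have "\<dots> = x"
    unfolding x using S(1) by (intro sum.mono_neutral_left) auto
  finally have "x = (\<Sum>v\<in>insert 0 S. u v *s v)" by simp
  moreover have "sum u (insert 0 S) = 1"
  proof -
    have "sum u (S - {0}) = sum r (S - {0})"
      by (intro sum.cong) (auto simp: u_def)
    then show ?thesis
      using sum.insert_remove[of S u 0] S(1) by (simp add: u_def)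
  qed
  ultimately show "x \<in> affine_span C"
    unfolding affine_span_def using S assms by blast
qed

definition linear_functional :: "('a::field ^ 'n \<Rightarrow> 'a) \<Rightarrow> bool" where
  "linear_functional f \<longleftrightarrow> (\<forall>x y. f (x + y) = f x + f y) \<and> (\<forall>c x. f (c *s x) = c * f x)"

text \<open>Subtracting \<open>f x / f v\<close> times \<open>v\<close> moves any \<open>x\<close>
  of \<open>S\<close> into the kernel of \<open>f\<close>, while \<open>v\<close> itself lies
  outside, so \<open>v\<close> adds exactly one dimension.\<close>

lemma dim_kernel_functional:
  fixes S :: "('a::field ^ 'n) set"
  assumes f: "linear_functional f" and S: "vec.subspace S" and v: "v \<in> S" "f v \<noteq> 0"
  shows "vec.subspace {x \<in> S. f x = 0}" "vec.dim {x \<in> S. f x = 0} + 1 = vec.dim S"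
proof -
  let ?K = "{x \<in> S. f x = 0}"
  have add: "f (x + y) = f x + f y" and scale: "f (c *s x) = c * f x" for x y c
    using f by (auto simp: linear_functional_def)
  have f0: "f 0 = 0"
    using scale[of 0 0] by simp
  show K: "vec.subspace ?K"
    using S by (auto intro!: vec.subspaceI simp: f0 add scale vec.subspace_0 vec.subspace_add
        vec.subspace_scale)
  have "vec.span (insert v ?K) = S"
  proof (rule vec.span_subspace)
    show "insert v ?K \<subseteq> S"
      using v by auto
    show "S \<subseteq> vec.span (insert v ?K)"
    proof
      fix x assume x: "x \<in> S"
      define c where "c = f x / f v"
      have "f (x - c *s v) = 0"
        using add[of "x - c *s v" "c *s v"] v(2) by (simp add: c_def scale del: vector_smult_lneg)
      then have "x - c *s v \<in> ?K"
        using x v S by (simp add: vec.subspace_diff vec.subspace_scale)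
      then show "x \<in> vec.span (insert v ?K)"
        unfolding vec.span_breakdown_eq by (intro exI vec.span_base)
    qed
  qed (rule S)
  then have "vec.dim S = vec.dim (insert v ?K)"
    by (metis vec.dim_span)
  also have "v \<notin> vec.span ?K"
    using K v by (metis (mono_tags, lifting) mem_Collect_eq vec.span_eq_iff)
  then have "vec.dim (insert v ?K) = vec.dim ?K + 1"
    by (simp add: vec.dim_insert)
  finally show "vec.dim ?K + 1 = vec.dim S" by simp
qed

text \<open>The vectors paired with the functionals witness, triangularly, that the functionals are
  independent.\<close>

lemma dim_common_kernel:
  fixes fs :: "(('a::field ^ 'n \<Rightarrow> 'a) \<times> ('a ^ 'n)) list"
  assumes "vec.subspace S"
    and "\<forall>p\<in>set fs. linear_functional (fst p) \<and> snd p \<in> S \<and> fst p (snd p) \<noteq> 0"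
    and "sorted_wrt (\<lambda>p q. fst p (snd q) = 0) fs"
  shows "vec.dim {x \<in> S. \<forall>p\<in>set fs. fst p x = 0} + length fs = vec.dim S"
  using assms
proof (induction fs arbitrary: S)
  case Nil
  then show ?case by simp
next
  case (Cons p fs)
  let ?K = "{x \<in> S. fst p x = 0}"
  have K: "vec.subspace ?K" "vec.dim ?K + 1 = vec.dim S"
    using dim_kernel_functional[of "fst p" S "snd p"] Cons.prems by simp_all
  have "vec.dim {x \<in> ?K. \<forall>p\<in>set fs. fst p x = 0} + length fs = vec.dim ?K"
    using Cons.prems by (intro Cons.IH K) auto
  moreover have "{x \<in> ?K. \<forall>p\<in>set fs. fst p x = 0} = {x \<in> S. \<forall>p\<in>set (p # fs). fst p x = 0}"
    by auto
  ultimately show ?case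
    using K(2) by simp
qed

section \<open>The twisted codes\<close>

text \<open>In \<open>tot\<close> and \<open>mom\<close> the index \<open>j\<close> is the first coordinate of a triple: 4, 7 or 10.\<close>

definition tot :: "13 \<Rightarrow> F3 ^ 13 \<Rightarrow> F3" where
  "tot j x = x $ j + x $ (j + 1) + x $ (j + 2)"

definition mom :: "13 \<Rightarrow> F3 ^ 13 \<Rightarrow> F3" where
  "mom j x = x $ (j + 1) - x $ (j + 2)"

text \<open>Both twists are sign functions of \<open>t\<close> for parameters 0 (no twist) and 1, but vanish somewhere for
  the parameter -1. For the parameter 1 their values at \<open>t = 0, 1, -1\<close> are 1, -1, -1 and 1, -1, 1;
  together with the constant 1 these are linearly independent, so their effects on the kernel do not
  interfere.\<close>

definition twist :: "F3 \<Rightarrow> F3 \<Rightarrow> F3" where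
  "twist a t = 1 + a * (t * t)"

definition twist' :: "F3 \<Rightarrow> F3 \<Rightarrow> F3" where
  "twist' d t = 1 - d * (t + t * t)"

lemma twist_cases: "a \<noteq> -1 \<Longrightarrow> twist a t = 1 \<or> twist a t = -1"
  by (cases a; cases t) (simp_all add: twist_def F3_tables)

lemma twist'_cases: "d \<noteq> -1 \<Longrightarrow> twist' d t = 1 \<or> twist' d t = -1"
  by (cases d; cases t) (simp_all add: twist'_def F3_tables)

definition syn1 :: "F3 \<Rightarrow> F3 \<Rightarrow> F3 ^ 13 \<Rightarrow> F3" where
  "syn1 a d x = x $ 0 + x $ 3 + twist' d (tot 4 x) * (x $ 1 + x $ 2) + twist a (tot 4 x) * mom 4 x
    + tot 4 x * tot 4 x + tot 10 x"

definition syn2 :: "F3 \<Rightarrow> F3 ^ 13 \<Rightarrow> F3" where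
  "syn2 a x = x $ 0 + x $ 1 - x $ 2 - x $ 3 + twist a (tot 7 x) * mom 7 x
    + tot 7 x * tot 7 x + tot 4 x"

definition syn3 :: "F3 \<Rightarrow> F3 ^ 13 \<Rightarrow> F3" where
  "syn3 a x = x $ 0 - x $ 1 + x $ 2 - x $ 3 + twist a (tot 10 x) * mom 10 x
    + tot 10 x * tot 10 x + tot 7 x"

definition twisted_code :: "F3 \<Rightarrow> F3 \<Rightarrow> F3 \<Rightarrow> F3 \<Rightarrow> (F3 ^ 13) set" where
  "twisted_code a b c d = {x. syn1 a d x = 0 \<and> syn2 b x = 0 \<and> syn3 c x = 0}"

section \<open>Syndromes of single errors and perfection\<close>

lemma tot_mom_diff_axis:
  "tot 4 (x - axis i a) = tot 4 x - (if i \<in> {4, 5, 6} then a else 0)"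
  "tot 7 (x - axis i a) = tot 7 x - (if i \<in> {7, 8, 9} then a else 0)"
  "tot 10 (x - axis i a) = tot 10 x - (if i \<in> {10, 11, 12} then a else 0)"
  "mom 4 (x - axis i a) = mom 4 x - (if i = 5 then a else if i = 6 then - a else 0)"
  "mom 7 (x - axis i a) = mom 7 x - (if i = 8 then a else if i = 9 then - a else 0)"
  "mom 10 (x - axis i a) = mom 10 x - (if i = 11 then a else if i = 12 then - a else 0)"
  by (auto simp: tot_def mom_def axis_def)

text \<open>Errors in the first four coordinates leave every \<open>tot\<close> unchanged, so all
  twists stay fixed and the effect is linear in \<open>s\<close>.\<close>

lemma syn_outer:
  "syn1 a d (x - axis 0 s) = syn1 a d x - s" "syn2 b (x - axis 0 s) = syn2 b x - s"
  "syn3 c (x - axis 0 s) = syn3 c x - s"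
  "syn1 a d (x - axis 1 s) = syn1 a d x - twist' d (tot 4 x) * s"
  "syn2 b (x - axis 1 s) = syn2 b x - s" "syn3 c (x - axis 1 s) = syn3 c x + s"
  "syn1 a d (x - axis 2 s) = syn1 a d x - twist' d (tot 4 x) * s"
  "syn2 b (x - axis 2 s) = syn2 b x + s" "syn3 c (x - axis 2 s) = syn3 c x - s"
  "syn1 a d (x - axis 3 s) = syn1 a d x - s" "syn2 b (x - axis 3 s) = syn2 b x + s"
  "syn3 c (x - axis 3 s) = syn3 c x + s"
  unfolding syn1_def syn2_def syn3_def tot_mom_diff_axis by (simp_all add: axis_def algebra_simps)

text \<open>Errors of equal size in one triple change \<open>tot\<close> alike and differ only
  through \<open>mom\<close>. The first place, of weight 0, serves as the reference.\<close>

lemma syn_triples: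
  "syn1 a d (x - axis 5 s) = syn1 a d (x - axis 4 s) - twist a (tot 4 x - s) * s"
  "syn1 a d (x - axis 6 s) = syn1 a d (x - axis 4 s) + twist a (tot 4 x - s) * s"
  "i \<in> {4, 5, 6} \<Longrightarrow> syn2 b (x - axis i s) = syn2 b x - s"
  "i \<in> {4, 5, 6} \<Longrightarrow> syn3 c (x - axis i s) = syn3 c x"
  "syn2 b (x - axis 8 s) = syn2 b (x - axis 7 s) - twist b (tot 7 x - s) * s"
  "syn2 b (x - axis 9 s) = syn2 b (x - axis 7 s) + twist b (tot 7 x - s) * s"
  "i \<in> {7, 8, 9} \<Longrightarrow> syn3 c (x - axis i s) = syn3 c x - s"
  "i \<in> {7, 8, 9} \<Longrightarrow> syn1 a d (x - axis i s) = syn1 a d x"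
  "syn3 c (x - axis 11 s) = syn3 c (x - axis 10 s) - twist c (tot 10 x - s) * s"
  "syn3 c (x - axis 12 s) = syn3 c (x - axis 10 s) + twist c (tot 10 x - s) * s"
  "i \<in> {10, 11, 12} \<Longrightarrow> syn1 a d (x - axis i s) = syn1 a d x - s"
  "i \<in> {10, 11, 12} \<Longrightarrow> syn2 b (x - axis i s) = syn2 b x"
  unfolding syn1_def syn2_def syn3_def tot_mom_diff_axis by (auto simp: axis_def algebra_simps)

lemma one_perfect_twisted_code:
  assumes "a \<noteq> -1" "b \<noteq> -1" "c \<noteq> -1" "d \<noteq> -1"
  shows "one_perfect (twisted_code a b c d)"
proof (rule one_perfectI)
  fix x
  let ?Q = "\<lambda>y. x - y \<in> twisted_code a b c d"
  define s1 s2 s3 h where s: "s1 = syn1 a d x" "s2 = syn2 b x" "s3 = syn3 c x"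
    "h = twist' d (tot 4 x)"
  define g1 g2 g3 where g: "g1 s = syn1 a d (x - axis 4 s)" "g2 s = syn2 b (x - axis 7 s)"
    "g3 s = syn3 c (x - axis 10 s)" for s
  define e1 e2 e3 where e: "e1 s = twist a (tot 4 x - s) * s" "e2 s = twist b (tot 7 x - s) * s"
    "e3 s = twist c (tot 10 x - s) * s" for s
  have e_nz: "e1 s \<noteq> 0" "e2 s \<noteq> 0" "e3 s \<noteq> 0" if "s \<noteq> 0" for s
    using that twist_cases[OF assms(1), of "tot 4 x - s"] twist_cases[OF assms(2), of "tot 7 x - s"]
      twist_cases[OF assms(3), of "tot 10 x - s"] by (auto simp: e)
  have h: "h = 1 \<or> h = -1"
    using twist'_cases[OF assms(4)] by (simp add: s)
  have Q:
    "?Q 0 \<longleftrightarrow> s1 = 0 \<and> s2 = 0 \<and> s3 = 0"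
    "?Q (axis 0 s) \<longleftrightarrow> s1 = s \<and> s2 = s \<and> s3 = s"
    "?Q (axis 1 s) \<longleftrightarrow> s1 = h * s \<and> s2 = s \<and> s3 = - s"
    "?Q (axis 2 s) \<longleftrightarrow> s1 = h * s \<and> s2 = - s \<and> s3 = s"
    "?Q (axis 3 s) \<longleftrightarrow> s1 = s \<and> s2 = - s \<and> s3 = - s"
    "?Q (axis 4 s) \<longleftrightarrow> g1 s = 0 \<and> s2 = s \<and> s3 = 0"
    "?Q (axis 5 s) \<longleftrightarrow> g1 s - e1 s = 0 \<and> s2 = s \<and> s3 = 0"
    "?Q (axis 6 s) \<longleftrightarrow> g1 s + e1 s = 0 \<and> s2 = s \<and> s3 = 0"
    "?Q (axis 7 s) \<longleftrightarrow> g2 s = 0 \<and> s3 = s \<and> s1 = 0"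
    "?Q (axis 8 s) \<longleftrightarrow> g2 s - e2 s = 0 \<and> s3 = s \<and> s1 = 0"
    "?Q (axis 9 s) \<longleftrightarrow> g2 s + e2 s = 0 \<and> s3 = s \<and> s1 = 0"
    "?Q (axis 10 s) \<longleftrightarrow> g3 s = 0 \<and> s1 = s \<and> s2 = 0"
    "?Q (axis 11 s) \<longleftrightarrow> g3 s - e3 s = 0 \<and> s1 = s \<and> s2 = 0"
    "?Q (axis 12 s) \<longleftrightarrow> g3 s + e3 s = 0 \<and> s1 = s \<and> s2 = 0" for s
    by (auto simp: twisted_code_def syn_outer syn_triples s g e eq_neg_iff_add_eq_0)
  have split: "card {i. y $ i \<noteq> 0} \<le> 1 \<and> ?Q y \<longleftrightarrow> (y = 0 \<and> ?Q 0) \<or>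
      (\<exists>i. y = axis i 1 \<and> ?Q (axis i 1)) \<or> (\<exists>i. y = axis i (-1) \<and> ?Q (axis i (-1)))" for y
    unfolding card_support_F3_le_1_iff by auto
  have "(2 :: F3) \<noteq> 0" "h \<noteq> 0"
    using h by (auto simp: two_finite_3 F3_tables)
  note simps = F3_one_simps e_nz this
  show "\<exists>!y. card {i. y $ i \<noteq> 0} \<le> 1 \<and> ?Q y"
  \<comment> \<open>Outside these three patterns the syndromes are all zero or all nonzero: no
    error, or one in the first four coordinates. In the nonzero case \<open>s2\<close> and
    \<open>s3\<close> leave two candidates, which require opposite values of \<open>s1\<close>
    whichever sign \<open>h\<close> is.\<close>
  proof (cases "s2 \<noteq> 0 \<and> s3 = 0 \<or> s3 \<noteq> 0 \<and> s1 = 0 \<or> s1 \<noteq> 0 \<and> s2 = 0")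
    case False
    then show ?thesis
      using h unfolding split ex_13 Q
      by (rule_tac F3_cases[of s1]; rule_tac F3_cases[of s2]; rule_tac F3_cases[of s3])
        (auto simp: simps)
  next
    case True
    then consider "s2 \<noteq> 0" "s3 = 0" | "s3 \<noteq> 0" "s1 = 0" | "s1 \<noteq> 0" "s2 = 0" by blast
    then show ?thesis
    proof cases
      case 1
      \<comment> \<open>The size of the error is \<open>s2\<close>. Its place is decided by which of
        the three shifts of \<open>g1 s2\<close> vanishes, whatever \<open>s1\<close> is. The other
        two cases are cyclic copies.\<close>
      show ?thesis
        unfolding split ex_13 Q
        by (rule F3_unique_shift[OF e_nz(1)[OF 1(1)], of "g1 s2"]; rule F3_cases[of s2];
            rule F3_cases[of s1]) (use 1 in \<open>simp_all add: simps\<close>)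
    next
      case 2
      show ?thesis
        unfolding split ex_13 Q
        by (rule F3_unique_shift[OF e_nz(2)[OF 2(1)], of "g2 s3"]; rule F3_cases[of s3];
            rule F3_cases[of s2]) (use 2 in \<open>simp_all add: simps\<close>)
    next
      case 3
      show ?thesis
        unfolding split ex_13 Q
        by (rule F3_unique_shift[OF e_nz(3)[OF 3(1)], of "g3 s1"]; rule F3_cases[of s1];
            rule F3_cases[of s3]) (use 3 in \<open>simp_all add: simps\<close>)
    qed
  qed
qed

section \<open>Full rank\<close>

lemma tot_mom_linear:
  "tot j (x + y) = tot j x + tot j y" "tot j (x - y) = tot j x - tot j y"
  "tot j (s *s x) = s * tot j x" "tot j (- x) = - tot j x"
  "mom j (x + y) = mom j x + mom j y" "mom j (x - y) = mom j x - mom j y"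
  "mom j (s *s x) = s * mom j x" "mom j (- x) = - mom j x"
  by (simp_all add: tot_def mom_def algebra_simps)

text \<open>The vector with prescribed first four coordinates and prescribed values of \<open>tot\<close> and \<open>mom\<close>.\<close>

definition code_vec :: "F3 \<Rightarrow> F3 \<Rightarrow> F3 \<Rightarrow> F3 \<Rightarrow> F3 \<Rightarrow> F3 \<Rightarrow> F3 \<Rightarrow> F3 \<Rightarrow> F3 \<Rightarrow> F3 \<Rightarrow> F3 ^ 13" where
  "code_vec u0 u1 u2 u3 t1 m1 t2 m2 t3 m3 = (\<chi> i. if i = 0 then u0 else if i = 1 then u1
    else if i = 2 then u2 else if i = 3 then u3 else if i = 4 then t1 - m1 else if i = 5 then m1
    else if i = 7 then t2 - m2 else if i = 8 then m2 else if i = 10 then t3 - m3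
    else if i = 11 then m3 else 0)"

lemma code_vec_nth:
  "code_vec u0 u1 u2 u3 t1 m1 t2 m2 t3 m3 $ 0 = u0"
  "code_vec u0 u1 u2 u3 t1 m1 t2 m2 t3 m3 $ 1 = u1"
  "code_vec u0 u1 u2 u3 t1 m1 t2 m2 t3 m3 $ 2 = u2"
  "code_vec u0 u1 u2 u3 t1 m1 t2 m2 t3 m3 $ 3 = u3"
  "code_vec u0 u1 u2 u3 t1 m1 t2 m2 t3 m3 $ 4 = t1 - m1"
  "code_vec u0 u1 u2 u3 t1 m1 t2 m2 t3 m3 $ 5 = m1"
  "code_vec u0 u1 u2 u3 t1 m1 t2 m2 t3 m3 $ 6 = 0"
  "code_vec u0 u1 u2 u3 t1 m1 t2 m2 t3 m3 $ 7 = t2 - m2"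
  "code_vec u0 u1 u2 u3 t1 m1 t2 m2 t3 m3 $ 8 = m2"
  "code_vec u0 u1 u2 u3 t1 m1 t2 m2 t3 m3 $ 9 = 0"
  "code_vec u0 u1 u2 u3 t1 m1 t2 m2 t3 m3 $ 10 = t3 - m3"
  "code_vec u0 u1 u2 u3 t1 m1 t2 m2 t3 m3 $ 11 = m3"
  "code_vec u0 u1 u2 u3 t1 m1 t2 m2 t3 m3 $ 12 = 0"
  by (simp_all add: code_vec_def)

lemma tot_mom_code_vec:
  "tot 4 (code_vec u0 u1 u2 u3 t1 m1 t2 m2 t3 m3) = t1"
  "mom 4 (code_vec u0 u1 u2 u3 t1 m1 t2 m2 t3 m3) = m1"
  "tot 7 (code_vec u0 u1 u2 u3 t1 m1 t2 m2 t3 m3) = t2"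
  "mom 7 (code_vec u0 u1 u2 u3 t1 m1 t2 m2 t3 m3) = m2"
  "tot 10 (code_vec u0 u1 u2 u3 t1 m1 t2 m2 t3 m3) = t3"
  "mom 10 (code_vec u0 u1 u2 u3 t1 m1 t2 m2 t3 m3) = m3"
  by (simp_all add: tot_def mom_def code_vec_nth)

lemma twist_0: "twist a 0 = 1" "twist' d 0 = 1"
  by (simp_all add: twist_def twist'_def)

lemma twist_square: "a \<noteq> -1 \<Longrightarrow> twist a t * twist a t = 1"
  using twist_cases[of a t] by auto

text \<open>Where all totals vanish, the squares vanish and the twists are 1, so membership reduces
  to the linear Hamming checks for all parameters.\<close>

lemma twisted_code_layer_0:
  assumes "tot 4 x = 0" "tot 7 x = 0" "tot 10 x = 0"
    and "x $ 0 + x $ 1 + x $ 2 + x $ 3 + mom 4 x = 0"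
    and "x $ 0 + x $ 1 - x $ 2 - x $ 3 + mom 7 x = 0"
    and "x $ 0 - x $ 1 + x $ 2 - x $ 3 + mom 10 x = 0"
  shows "x \<in> twisted_code a b c d"
  using assms by (simp add: twisted_code_def syn1_def syn2_def syn3_def twist_0 add_ac)

lemma full_rank_twisted_code:
  assumes "a \<noteq> -1" "b \<noteq> -1" "c \<noteq> -1"
  shows "full_rank (twisted_code a b c d)"
proof -
  let ?C = "twisted_code a b c d"
  \<comment> \<open>For \<open>s\<close> equal to 1 or -1, one \<open>mom\<close> cancels the square
    of the total \<open>s\<close> in its own check, and the \<open>mom\<close> of the cyclically
    next triple cancels \<open>s\<close> where it enters linearly.\<close>
  define w1 w2 w3 where "w1 s = code_vec 0 0 0 0 s (- twist a s) 0 (- s) 0 0"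
    "w2 s = code_vec 0 0 0 0 0 0 s (- twist b s) 0 (- s)"
    "w3 s = code_vec 0 0 0 0 0 (- s) 0 0 s (- twist c s)" for s
  define q1 q2 q3 where "q1 = code_vec 0 0 0 0 0 1 0 0 0 0" "q2 = code_vec 0 0 0 0 0 0 0 1 0 0"
    "q3 = code_vec 0 0 0 0 0 0 0 0 0 1"
  note w = w1_w2_w3_def and q = q1_q2_q3_def
  have C: "w1 s \<in> ?C" "w2 s \<in> ?C" "w3 s \<in> ?C" if "s = 1 \<or> s = -1" for s
    using that assms
    by (auto simp: w twisted_code_def syn1_def syn2_def syn3_def tot_mom_code_vec
        code_vec_nth twist_0 twist_square)
  \<comment> \<open>\<open>twist\<close> is even and the squares at 1 and -1 agree, so in the sum
    the linear parts cancel while the two equal values of \<open>mom\<close> add up to a nonzero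
    one. This is where nonlinearity enlarges the span.\<close>
  have "q1 = twist a 1 *s (w1 1 + w1 (-1))" "q2 = twist b 1 *s (w2 1 + w2 (-1))"
    "q3 = twist c 1 *s (w3 1 + w3 (-1))"
    using assms
    by (cases a; cases b; cases c; simp add: w q vec_eq_iff all_13 code_vec_nth twist_def F3_tables)+
  then have q_span: "q1 \<in> vec.span ?C" "q2 \<in> vec.span ?C" "q3 \<in> vec.span ?C"
    by (simp_all only:) (intro vec.span_scale vec.span_add vec.span_base C; simp)+
  have layer_0: "x \<in> vec.span ?C" if "tot 4 x = 0" "tot 7 x = 0" "tot 10 x = 0" for x
  proof -
    define r1 r2 r3 where r: "r1 = x $ 0 + x $ 1 + x $ 2 + x $ 3 + mom 4 x"
      "r2 = x $ 0 + x $ 1 - x $ 2 - x $ 3 + mom 7 x"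
      "r3 = x $ 0 - x $ 1 + x $ 2 - x $ 3 + mom 10 x"
    \<comment> \<open>Each of \<open>q1\<close>, \<open>q2\<close>, \<open>q3\<close> violates
      exactly one linear check, with value 1, so subtracting the defects repairs all three
      checks.\<close>
    have "x - r1 *s q1 - r2 *s q2 - r3 *s q3 \<in> ?C"
      by (rule twisted_code_layer_0)
        (simp_all add: that tot_mom_linear q tot_mom_code_vec code_vec_nth, simp_all add: r)
    then have "x - r1 *s q1 - r2 *s q2 - r3 *s q3 + r3 *s q3 + r2 *s q2 + r1 *s q1 \<in> vec.span ?C"
      using q_span by (intro vec.span_add vec.span_scale) (rule vec.span_base)
    then show ?thesis by simp
  qed
  have "x \<in> vec.span ?C" for x
  proof -
    \<comment> \<open>The codewords \<open>w1 1\<close>, \<open>w2 1\<close> and \<open>w3 1\<close>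
      each have a single nonzero total, equal to 1, so they clear the totals of
      \<open>x\<close>.\<close>
    define y where "y = x - tot 4 x *s w1 1 - tot 7 x *s w2 1 - tot 10 x *s w3 1"
    have "y \<in> vec.span ?C"
      by (rule layer_0) (simp_all add: y_def tot_mom_linear w tot_mom_code_vec)
    then have "y + tot 10 x *s w3 1 + tot 7 x *s w2 1 + tot 4 x *s w1 1 \<in> vec.span ?C"
      using C by (intro vec.span_add vec.span_scale) (auto intro: vec.span_base)
    then show ?thesis by (simp add: y_def)
  qed
  moreover have "0 \<in> ?C"
    by (rule twisted_code_layer_0) (simp_all add: tot_def mom_def)
  ultimately show ?thesis
    unfolding full_rank_def using span_subset_affine_span[of ?C] by blast
qed

section \<open>Periods and the dimension of the kernel\<close>

text \<open>The order matters: the first six functionals cut out the kernel without twists, and the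
  last four are the conditions added by the parameters \<open>a\<close>, \<open>b\<close>,
  \<open>c\<close>, \<open>d\<close> in turn. Every kernel needed is thus given by a prefix of the
  list.\<close>

definition kernel_functionals :: "((F3 ^ 13 \<Rightarrow> F3) \<times> (F3 ^ 13)) list" where
  "kernel_functionals =
    [(tot 4, code_vec 0 0 0 0 1 0 0 0 0 0), (tot 7, code_vec 0 0 0 0 0 0 1 0 0 0),
     (tot 10, code_vec 0 0 0 0 0 0 0 0 1 0),
     (\<lambda>x. x $ 0 + x $ 1 + x $ 2 + x $ 3 + mom 4 x, code_vec 0 0 0 0 0 1 0 0 0 0),
     (\<lambda>x. x $ 0 + x $ 1 - x $ 2 - x $ 3 + mom 7 x, code_vec 0 0 0 0 0 0 0 1 0 0),
     (\<lambda>x. x $ 0 - x $ 1 + x $ 2 - x $ 3 + mom 10 x, code_vec 0 0 0 0 0 0 0 0 0 1),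
     (mom 4, code_vec (-1) 0 0 0 0 1 0 1 0 1), (mom 7, code_vec 1 0 0 (-1) 0 0 0 1 0 1),
     (mom 10, code_vec 1 (-1) 0 0 0 0 0 0 0 1),
     (\<lambda>x. x $ 1 + x $ 2, code_vec 1 (-1) (-1) 1 0 0 0 0 0 0)]"

lemma linear_kernel_functionals: "p \<in> set kernel_functionals \<Longrightarrow> linear_functional (fst p)"
  unfolding kernel_functionals_def
  by (auto simp: linear_functional_def tot_mom_linear algebra_simps)

lemma dim_kernel_functionals:
  assumes "n \<le> 10"
  shows "vec.dim {x. \<forall>p\<in>set (take n kernel_functionals). fst p x = 0} = 13 - n"
proof -
  have "sorted_wrt (\<lambda>p q. fst p (snd q) = 0) kernel_functionals"
    by (simp add: kernel_functionals_def tot_mom_code_vec code_vec_nth F3_three)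
  moreover have "fst p (snd p) \<noteq> 0" if "p \<in> set kernel_functionals" for p
    using that by (auto simp: kernel_functionals_def tot_mom_code_vec code_vec_nth)
      (simp_all add: two_finite_3 F3_tables)
  moreover have "length (take n kernel_functionals) = n"
    using assms by (simp add: kernel_functionals_def)
  ultimately have "vec.dim {x. \<forall>p\<in>set (take n kernel_functionals). fst p x = 0} + n
      = vec.dim (UNIV :: (F3 ^ 13) set)"
    using dim_common_kernel[of UNIV "take n kernel_functionals"] linear_kernel_functionals
    by (metis (no_types, lifting) Collect_cong UNIV_I in_set_takeD sorted_wrt_take vec.subspace_UNIV)
  then show ?thesis
    unfolding vec_dim_card by simp
qed

lemma subspace_kernel_functionals:
  "vec.subspace {x. \<forall>p\<in>set (take n kernel_functionals). fst p x = 0}"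
proof -
  have lin: "linear_functional (fst p)" if "p \<in> set (take n kernel_functionals)" for p
    using that linear_kernel_functionals in_set_takeD by metis
  have "fst p 0 = 0" if "p \<in> set (take n kernel_functionals)" for p
    using lin[OF that] unfolding linear_functional_def by (metis mult_zero_left vector_smult_lzero)
  with lin show ?thesis
    by (intro vec.subspaceI) (auto simp: linear_functional_def)
qed

text \<open>Comparing coefficients of \<open>m\<close> and \<open>n\<close> shows that
  \<open>u\<close> is a period of both twists. A nonconstant function on the field has no nonzero
  period, and if both twists are constant, the square excludes one. With \<open>u = 0\<close>,
  evaluation at 0, -1 and 1 separates the remaining conditions.\<close>

lemma quadratic_twist_period':
  assumes a: "a \<noteq> -1" and d: "d \<noteq> -1"
    and eq: "\<And>t m n. twist' d (t + u) * (n + w) + twist a (t + u) * (m + v) + (t + u) * (t + u) + k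
      = twist' d t * n + twist a t * m + t * t"
  shows "u = 0 \<and> a * v = 0 \<and> d * w = 0 \<and> w + v + k = 0"
proof -
  have A: "twist a (t + u) = twist a t" for t
    using arg_cong2[OF eq[of t 0 1] eq[of t 0 0], of minus] by (simp add: distrib_left)
  have D: "twist' d (t + u) = twist' d t" for t
    using arg_cong2[OF eq[of t 1 0] eq[of t 0 0], of minus] by (simp add: distrib_left)
  have E: "twist' d t * w + twist a t * v + (t + u) * (t + u) + k = t * t" for t
    using eq[of t 0 0] unfolding A D by simp
  have "u = 0 \<or> a = 0"
    using A[of 0] A[of 1] A[of "-1"] a by (cases a; cases u) (simp_all add: twist_def F3_tables)
  moreover have "u = 0 \<or> d = 0"
    using D[of 0] D[of 1] D[of "-1"] d by (cases d; cases u) (simp_all add: twist'_def F3_tables)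
  moreover have "u = 0" if "a = 0" "d = 0"
  proof -
    have "(1 + u) * (1 + u) - u * u = 1"
      using arg_cong2[OF E[of 1] E[of 0], of minus] that by (simp add: twist_def twist'_def)
    then show ?thesis
      by (cases u) (simp_all add: F3_tables)
  qed
  ultimately have u: "u = 0" by blast
  have 0: "w + v + k = 0"
    using E[of 0] by (simp add: u twist_0)
  \<comment> \<open>At -1 the factor \<open>twist' d\<close> is still 1, so the difference from the
    value at 0 isolates \<open>a * v\<close>.\<close>
  have av: "a * v = 0"
    using arg_cong2[OF E[of "-1"] 0, of minus] by (simp add: u twist_def twist'_def algebra_simps)
  have "twist' d 1 = 1 + d"
    by (cases d) (simp_all add: twist'_def F3_tables)
  then have "d * w = 0"
    using arg_cong2[OF E[of 1] 0, of minus] av by (auto simp: u twist_def algebra_simps)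
  with u 0 av show ?thesis by blast
qed

lemma quadratic_twist_period:
  assumes "b \<noteq> -1"
    and "\<And>t m. twist b (t + u) * (m + v) + (t + u) * (t + u) + k = twist b t * m + t * t"
  shows "u = 0 \<and> b * v = 0 \<and> v + k = 0"
  using quadratic_twist_period'[of b 0 u 0 v k] assms by (simp add: twist'_def add.assoc)

text \<open>By the conditions on products, each twist acts trivially on \<open>w\<close> at every
  argument. Adding \<open>w\<close> therefore changes each syndrome by a linear check of
  \<open>w\<close>, which is zero.\<close>

lemma twisted_code_add_period:
  assumes "tot 4 w = 0" "tot 7 w = 0" "tot 10 w = 0"
    and s: "w $ 0 + w $ 1 + w $ 2 + w $ 3 + mom 4 w = 0"
      "w $ 0 + w $ 1 - w $ 2 - w $ 3 + mom 7 w = 0"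
      "w $ 0 - w $ 1 + w $ 2 - w $ 3 + mom 10 w = 0"
    and z: "a * mom 4 w = 0" "b * mom 7 w = 0" "c * mom 10 w = 0" "d * (w $ 1 + w $ 2) = 0"
  shows "x + w \<in> twisted_code a b c d \<longleftrightarrow> x \<in> twisted_code a b c d"
proof -
  have twist: "twist a t * mom 4 w = mom 4 w"
    "twist b t * mom 7 w = mom 7 w" "twist c t * mom 10 w = mom 10 w" for t
    using z by (auto simp: twist_def distrib_right)
  have twist': "twist' d t * (w $ 1 + w $ 2) = w $ 1 + w $ 2" for t
    using z(4) by (auto simp: twist'_def left_diff_distrib)
  have "syn1 a d (x + w) = syn1 a d x + (w $ 0 + twist' d (tot 4 x) * (w $ 1 + w $ 2) + w $ 3
      + twist a (tot 4 x) * mom 4 w)"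
    "syn2 b (x + w) = syn2 b x + (w $ 0 + w $ 1 - w $ 2 - w $ 3 + twist b (tot 7 x) * mom 7 w)"
    "syn3 c (x + w) = syn3 c x + (w $ 0 - w $ 1 + w $ 2 - w $ 3 + twist c (tot 10 x) * mom 10 w)"
    unfolding syn1_def syn2_def syn3_def using assms(1-3)
    by (simp_all add: tot_mom_linear algebra_simps)
  moreover have "w $ 0 + (w $ 1 + w $ 2) + w $ 3 + mom 4 w = 0"
    using s(1) by (simp add: add_ac)
  ultimately show ?thesis
    unfolding twisted_code_def twist twist' using s(2,3) by simp
qed

lemma periods_twisted_code:
  assumes "a \<noteq> -1" "b \<noteq> -1" "c \<noteq> -1" "d \<noteq> -1"
  shows "periods (twisted_code a b c d) = {w. tot 4 w = 0 \<and> tot 7 w = 0 \<and> tot 10 w = 0 \<and>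
    w $ 0 + w $ 1 + w $ 2 + w $ 3 + mom 4 w = 0 \<and> w $ 0 + w $ 1 - w $ 2 - w $ 3 + mom 7 w = 0 \<and>
    w $ 0 - w $ 1 + w $ 2 - w $ 3 + mom 10 w = 0 \<and>
    a * mom 4 w = 0 \<and> b * mom 7 w = 0 \<and> c * mom 10 w = 0 \<and> d * (w $ 1 + w $ 2) = 0}"
    (is "periods ?C = ?K")
proof (intro equalityI subsetI)
  fix w assume w: "w \<in> ?K"
  have shift: "x + w \<in> ?C \<longleftrightarrow> x \<in> ?C" for x
    using w by (intro twisted_code_add_period) auto
  show "w \<in> periods ?C"
    unfolding periods_def mem_Collect_eq
  proof (intro equalityI subsetI)
    fix x assume "x \<in> ?C"
    then have "x - w \<in> ?C"
      using shift[of "x - w"] by simp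
    then show "x \<in> (\<lambda>c. c + w) ` ?C"
      by (rule rev_image_eqI) simp
  qed (use shift in blast)
next
  fix w assume "w \<in> periods ?C"
  then have w: "x + w \<in> ?C" if "x \<in> ?C" for x
    using that by (auto simp: periods_def)
  note eval = twisted_code_def syn1_def syn2_def syn3_def tot_mom_linear
    tot_mom_code_vec code_vec_nth twist_0
  have 1: "tot 4 w = 0 \<and> a * mom 4 w = 0 \<and> d * (w $ 1 + w $ 2) = 0 \<and>
      w $ 1 + w $ 2 + mom 4 w + (w $ 0 + w $ 3 + tot 10 w) = 0"
  proof (rule quadratic_twist_period'[OF assms(1,4)])
    fix t m n
    define z where "z = twist' d t * n + twist a t * m + t * t"
    \<comment> \<open>Here \<open>t\<close>, \<open>m\<close> and \<open>n\<close> are free: the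
      first coordinate balances the first check, and the \<open>mom\<close> entries of the other
      triples balance the other two. The first check of the translate by \<open>w\<close> then gives
      the required identity.\<close>
    have "code_vec (- z) n 0 0 t m 0 (z - n - t) 0 (z + n) \<in> ?C"
      by (simp add: eval) (simp add: z_def)
    from w[OF this] show "twist' d (t + tot 4 w) * (n + (w $ 1 + w $ 2))
        + twist a (t + tot 4 w) * (m + mom 4 w)
        + (t + tot 4 w) * (t + tot 4 w) + (w $ 0 + w $ 3 + tot 10 w)
      = twist' d t * n + twist a t * m + t * t"
      unfolding z_def[symmetric] by (simp add: eval algebra_simps)
  qed
  have 2: "tot 7 w = 0 \<and> b * mom 7 w = 0 \<and>
      mom 7 w + (w $ 0 + w $ 1 - w $ 2 - w $ 3 + tot 4 w) = 0"
  proof (rule quadratic_twist_period[OF assms(2)])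
    fix t m
    define z where "z = twist b t * m + t * t"
    have "code_vec (- z) 0 0 0 0 z t m 0 (z - t) \<in> ?C"
      by (simp add: eval) (simp add: z_def)
    from w[OF this] show "twist b (t + tot 7 w) * (m + mom 7 w) + (t + tot 7 w) * (t + tot 7 w)
        + (w $ 0 + w $ 1 - w $ 2 - w $ 3 + tot 4 w) = twist b t * m + t * t"
      unfolding z_def[symmetric] by (simp add: eval algebra_simps)
  qed
  have 3: "tot 10 w = 0 \<and> c * mom 10 w = 0 \<and>
      mom 10 w + (w $ 0 - w $ 1 + w $ 2 - w $ 3 + tot 7 w) = 0"
  proof (rule quadratic_twist_period[OF assms(3)])
    fix t m
    define z where "z = twist c t * m + t * t"
    have "code_vec (- z) 0 0 0 0 (z - t) 0 z t m \<in> ?C"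
      by (simp add: eval) (simp add: z_def)
    from w[OF this] show "twist c (t + tot 10 w) * (m + mom 10 w) + (t + tot 10 w) * (t + tot 10 w)
        + (w $ 0 - w $ 1 + w $ 2 - w $ 3 + tot 7 w) = twist c t * m + t * t"
      unfolding z_def[symmetric] by (simp add: eval algebra_simps)
  qed
  from 1 2 3 show "w \<in> ?K"
    by (simp add: algebra_simps)
qed

lemma code_kernel_eq_periods:
  "vec.subspace (periods C) \<Longrightarrow> code_kernel C = periods C"
  by (intro equalityI code_kernel_subset_periods code_kernel_greatest) auto

theorem theorem3:
  fixes k :: nat
  assumes "k \<in> {3, 4, 5, 6, 7}"
  shows "\<exists>C :: (F3 ^ 13) set. one_perfect C \<and> full_rank C \<and> vec.dim (code_kernel C) = k"
proof -
  \<comment> \<open>The \<open>7 - k\<close> active parameters come first in the order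
    \<open>a\<close>, \<open>b\<close>, \<open>c\<close>, \<open>d\<close>, and a zero parameter
    makes its condition void. Together with the six common conditions this is the prefix of length
    \<open>13 - k\<close>.\<close>
  define p :: "nat \<Rightarrow> F3" where "p n = (if k \<le> n then 1 else 0)" for n
  let ?C = "twisted_code (p 6) (p 5) (p 4) (p 3)"
  have p: "p n \<noteq> -1" for n
    by (simp add: p_def F3_one_simps)
  have P: "periods ?C = {x. \<forall>q\<in>set (take (13 - k) kernel_functionals). fst q x = 0}"
    unfolding periods_twisted_code[OF p p p p]
    using assms by (auto simp: p_def kernel_functionals_def)
  then have "code_kernel ?C = periods ?C"
    using subspace_kernel_functionals by (intro code_kernel_eq_periods) simp
  then have "vec.dim (code_kernel ?C) = k"
    using dim_kernel_functionals[of "13 - k"] assms unfolding P by auto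
  moreover have "one_perfect ?C"
    by (intro one_perfect_twisted_code p)
  moreover have "full_rank ?C"
    by (intro full_rank_twisted_code p)
  ultimately show ?thesis by blast
qed

end
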